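(* Let $r\ge 4$, let $d,m_1,\dots,m_r$ be non-negative integers, and let $\mathcal{L}=\mathcal{L}_3(d,m_1,\dots,m_r)$. Suppose that $2d\ge m_i+m_j+m_k$ for every choice of three distinct indices $\{i,j,k\}\subset\{1,2,3,4\}$. For $1\le i<j\le 4$ put $t_{ij}=m_i+m_j-d$. Then $$v(\mathrm{Cr}(\mathcal{L}))-v(\mathcal{L})=\sum_{t_{ij}\ge 2}\binom{1+t_{ij}}{3}-\sum_{t_{ij}\le -2}\binom{1-t_{ij}}{3},$$ where the sums are over pairs $1\le i<j\le4$ satisfying the indicated condition.
   Context: $\mathcal{L}_3(d,m_1,\dots,m_r)$ denotes the linear system of degree $d$ surfaces of $\mathbb{P}^3$ (over $\mathbb{C}$) having multiplicity at least $m_i$ at $p_i$, for given points $p_1,\dots,p_r$. Its virtual dimension is $$v(\mathcal{L}_3(d,m_1,\dots,m_r))=\binom{d+3}{3}-\sum_{i=1}^r\binom{m_i+2}{3}-1.$$ The cubic Cremona transformation based at $p_1,\dots,p_4$ (taken as the coordinate points), $(x_1:x_2:x_3:x_4)\dashrightarrow(x_1^{-1}:x_2^{-1}:x_3^{-1}:x_4^{-1})$, transforms $\mathcal{L}=\mathcal{L}_3(d,m_1,\dots,m_r)$ into $$\mathrm{Cr}(\mathcal{L})=\mathcal{L}_3(d+k,m_1+k,\dots,m_4+k,m_5,\dots,m_r),\qquad k=2d-\sum_{i=1}^4m_i.$$ *)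

theory Defs
  imports Complex_Main
begin

text \<open>
  \<open>L3 r d m\<close> stands for the linear system of degree \<open>d\<close> surfaces of complex projective
  3-space with multiplicity at least \<open>m i\<close> at a given point \<open>p i\<close>, for \<open>1 \<le> i \<le> r\<close>.
  It is represented by its numerical data: the virtual dimension depends only on these data
  (and is not determined by the set of surfaces, since systems with different data may both
  be empty), and the Cremona transformation acts on them by a closed formula.
  Values of \<open>m\<close> outside \<open>{1..r}\<close> are irrelevant.  The data are integers because the
  Cremona transformation changes them by a possibly negative amount.
\<close>

datatype linear_system = L3 (num_points: nat) (degree: int) (mult: "nat \<Rightarrow> int")

text \<open>
  On nonnegative data these are the ordinary binomial coefficients; the conversion \<open>nat\<close>
  only matters for negative arguments, where the coefficient is 0.
\<close>

definition vdim :: "linear_system \<Rightarrow> int" where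
  "vdim L = int (nat (degree L + 3) choose 3)
     - (\<Sum>i = 1..num_points L. int (nat (mult L i + 2) choose 3)) - 1"

text \<open>
  Meaningful for at least four points, the first four being the base points of the
  cubic Cremona transformation.
\<close>

definition cremona_shift :: "linear_system \<Rightarrow> int" where
  "cremona_shift L = 2 * degree L - (\<Sum>i = 1..4. mult L i)"

definition cremona :: "linear_system \<Rightarrow> linear_system" where
  "cremona L = L3 (num_points L) (degree L + cremona_shift L)
     (\<lambda>i. if i \<in> {1..4} then mult L i + cremona_shift L else mult L i)"

end

theory Submission
  imports Defs
begin

text \<open>
  The triple conditions keep all data of the transformed system nonnegative, so every binomial
  coefficient is given by its cubic polynomial.  A pair contributes \<open>(t\<^sup>3 - t) / 6\<close> to the
  right-hand side whatever the sign of \<open>t\<close>, because this polynomial is odd and vanishes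
  for \<open>\<bar>t\<bar> \<le> 1\<close>.  What remains is a polynomial identity.
\<close>

text \<open>The factor 6 clears the denominator, so all later comparisons of cubic polynomials stay
  in the integers. For \<open>x\<close> = 0, 1, 2 both sides vanish.\<close>

lemma six_times_choose_3:
  fixes x :: int
  assumes "x \<ge> 0"
  shows "6 * int (nat x choose 3) = x * (x - 1) * (x - 2)"
proof -
  have "6 * int (n choose 3) = int n * (int n - 1) * (int n - 2)" for n
  proof (induction n)
    case (Suc n)
    \<comment> \<open>Pascal's rule for \<open>choose 3\<close> brings in \<open>choose 2\<close>,
      whose polynomial form needs its own induction.\<close>
    have "2 * int (n choose 2) = int n * (int n - 1)"
    proof (induction n)
      case (Suc n)
      then show ?case by (simp add: numeral_2_eq_2 algebra_simps)
    qed simp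
    moreover have "Suc n choose 3 = (n choose 2) + (n choose 3)"
      by (simp add: numeral_3_eq_3 numeral_2_eq_2)
    ultimately show ?case using Suc.IH by (simp add: algebra_simps)
  qed simp
  from this[of "nat x"] assms show ?thesis by simp
qed

lemma six_times_pair_contribution:
  fixes t :: int
  shows "6 * ((if t \<ge> 2 then int (nat (1 + t) choose 3) else 0)
    - (if t \<le> - 2 then int (nat (1 - t) choose 3) else 0)) = t ^ 3 - t"
proof -
  consider "t \<ge> 2" | "t \<le> - 2" | "t = - 1" | "t = 0" | "t = 1" by linarith
  then show ?thesis
  proof cases
    case 1
    then show ?thesis
      using six_times_choose_3[of "1 + t"] by (simp add: algebra_simps power3_eq_cube)
  next
    case 2
    then show ?thesis
      using six_times_choose_3[of "1 - t"] by (simp add: algebra_simps power3_eq_cube)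
  qed simp_all
qed

text \<open>Moving the condition \<open>P\<close> from the index set into the summand makes both
  sums of the theorem range over the same six pairs, so they can be combined pair by pair.\<close>

lemma sum_pairs_upto_4:
  fixes f :: "nat \<Rightarrow> nat \<Rightarrow> int"
  shows "(\<Sum>(i, j) \<in> {(i, j). 1 \<le> i \<and> i < j \<and> j \<le> 4 \<and> P i j}. f i j) =
    (\<Sum>(i, j) \<in> {(1, 2), (1, 3), (1, 4), (2, 3), (2, 4), (3, 4)}. if P i j then f i j else 0)"
proof -
  let ?S = "{(1, 2), (1, 3), (1, 4), (2, 3), (2, 4), (3, 4)} :: (nat \<times> nat) set"
  have "{(i, j). 1 \<le> i \<and> i < j \<and> j \<le> 4 \<and> P i j} = {p \<in> ?S. P (fst p) (snd p)}"
    by auto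
  moreover have "(\<Sum>p \<in> {p \<in> ?S. P (fst p) (snd p)}. f (fst p) (snd p)) =
      (\<Sum>p \<in> ?S. if P (fst p) (snd p) then f (fst p) (snd p) else 0)"
    by (rule sum.inter_filter) simp
  ultimately show ?thesis by (simp add: case_prod_unfold)
qed

text \<open>The Cremona transformation changes only the first four multiplicities; the sum from 5 on
  is common to both systems and cancels in the difference.\<close>

lemma vdim_first_four:
  assumes "r \<ge> 4"
  shows "vdim (L3 r d m) = int (nat (d + 3) choose 3)
    - (int (nat (m 1 + 2) choose 3) + int (nat (m 2 + 2) choose 3)
      + int (nat (m 3 + 2) choose 3) + int (nat (m 4 + 2) choose 3))
    - (\<Sum>i = 5..r. int (nat (m i + 2) choose 3)) - 1"
proof -
  have "{1..r} = {1, 2, 3, 4} \<union> {5..r}" using assms by auto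
  then have "(\<Sum>i = 1..r. int (nat (m i + 2) choose 3)) =
      (\<Sum>i \<in> {1, 2, 3, 4}. int (nat (m i + 2) choose 3))
      + (\<Sum>i = 5..r. int (nat (m i + 2) choose 3))"
    by (simp only:) (rule sum.union_disjoint, auto)
  then show ?thesis by (simp add: vdim_def)
qed

theorem proposition2p3:
  fixes r d :: nat and m :: "nat \<Rightarrow> nat" and t :: "nat \<Rightarrow> nat \<Rightarrow> int"
    and L :: linear_system
  assumes r: "r \<ge> 4"
    and L: "L = L3 r (int d) (\<lambda>i. int (m i))"
    and triples: "\<And>i j k. i \<in> {1..4} \<Longrightarrow> j \<in> {1..4} \<Longrightarrow> k \<in> {1..4} \<Longrightarrow>
      i \<noteq> j \<Longrightarrow> i \<noteq> k \<Longrightarrow> j \<noteq> k \<Longrightarrow> 2 * d \<ge> m i + m j + m k"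
    and t: "\<And>i j. 1 \<le> i \<Longrightarrow> i < j \<Longrightarrow> j \<le> 4 \<Longrightarrow> t i j = int (m i) + int (m j) - int d"
  shows "vdim (cremona L) - vdim L =
      (\<Sum>(i, j) \<in> {(i, j). 1 \<le> i \<and> i < j \<and> j \<le> 4 \<and> t i j \<ge> 2}. int (nat (1 + t i j) choose 3))
    - (\<Sum>(i, j) \<in> {(i, j). 1 \<le> i \<and> i < j \<and> j \<le> 4 \<and> t i j \<le> - 2}. int (nat (1 - t i j) choose 3))"
proof -
  define D a b c e where "D = int d" and "a = int (m 1)" and "b = int (m 2)"
    and "c = int (m 3)" and "e = int (m 4)"
  define k where "k = 2 * D - (a + b + c + e)"
  note defs = D_def a_def b_def c_def e_def
  have nonneg: "D \<ge> 0" "a \<ge> 0" "b \<ge> 0" "c \<ge> 0" "e \<ge> 0"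
    by (simp_all add: defs)
  have triple: "2 * D \<ge> a + b + c" "2 * D \<ge> a + b + e" "2 * D \<ge> a + c + e" "2 * D \<ge> b + c + e"
    using triples[of 1 2 3] triples[of 1 2 4] triples[of 1 3 4] triples[of 2 3 4]
    by (simp_all add: defs)
  have "{1..4} = {1, 2, 3, 4 :: nat}" by auto
  then have "cremona_shift L = k"
    by (simp add: cremona_shift_def L k_def defs)
  then have cr: "cremona L = L3 r (D + k) (\<lambda>i. if i \<in> {1..4} then int (m i) + k else int (m i))"
    by (simp add: cremona_def L D_def cong: if_cong)
  let ?C = "\<lambda>x. int (nat x choose 3)"
  let ?R = "\<Sum>i = 5..r. ?C (int (m i) + 2)"
  have vL: "vdim L = ?C (D + 3) - (?C (a + 2) + ?C (b + 2) + ?C (c + 2) + ?C (e + 2)) - ?R - 1"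
    unfolding L vdim_first_four[OF r] by (simp add: defs)
  have vCr: "vdim (cremona L) = ?C (D + k + 3)
      - (?C (a + k + 2) + ?C (b + k + 2) + ?C (c + k + 2) + ?C (e + k + 2)) - ?R - 1"
    unfolding cr vdim_first_four[OF r] by (simp add: defs)
  let ?g = "\<lambda>u. (if u \<ge> 2 then ?C (1 + u) else 0) - (if u \<le> - 2 then ?C (1 - u) else 0)"
  have rhs: "(\<Sum>(i, j) \<in> {(i, j). 1 \<le> i \<and> i < j \<and> j \<le> 4 \<and> t i j \<ge> 2}. ?C (1 + t i j))
      - (\<Sum>(i, j) \<in> {(i, j). 1 \<le> i \<and> i < j \<and> j \<le> 4 \<and> t i j \<le> - 2}. ?C (1 - t i j))
      = ?g (a + b - D) + ?g (a + c - D) + ?g (a + e - D)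
        + ?g (b + c - D) + ?g (b + e - D) + ?g (c + e - D)"
    unfolding sum_pairs_upto_4 by (simp add: t defs)
  have cube: "6 * ?C (x + 2) = (x + 2) * (x + 1) * x" if "x \<ge> 0" for x
    using six_times_choose_3[of "x + 2"] that by (simp add: algebra_simps)
  \<comment> \<open>Each shifted multiplicity is 2D minus the other three, as in
    \<open>a + k = 2 * D - (b + c + e)\<close>, hence nonnegative by one triple condition. Adding
    all four conditions gives 3(a + b + c + e) \<le> 8D \<le> 9D, which is
    \<open>D + k \<ge> 0\<close>.\<close>
  have "D + k \<ge> 0" "a + k \<ge> 0" "b + k \<ge> 0" "c + k \<ge> 0" "e + k \<ge> 0"
    using triple nonneg by (simp_all add: k_def)
  note cubes = this[THEN cube] nonneg[THEN cube]
  have top: "6 * ?C (D + 3) = (D + 3) * (D + 2) * (D + 1)"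
    "6 * ?C (D + k + 3) = (D + k + 3) * (D + k + 2) * (D + k + 1)"
    using six_times_choose_3[of "D + 3"] six_times_choose_3[of "D + k + 3"] nonneg \<open>D + k \<ge> 0\<close>
    by (simp_all add: algebra_simps)
  \<comment> \<open>Stated for arbitrary integers so that 6 is distributed and the tail
    \<open>y\<close> cancelled with the binomial coefficients as opaque atoms.\<close>
  have lin: "6 * (x0' - (x1' + x2' + x3' + x4') - y - 1 - (x0 - (x1 + x2 + x3 + x4) - y - 1)) =
      6 * x0' - 6 * x0 - (6 * x1' - 6 * x1) - (6 * x2' - 6 * x2) - (6 * x3' - 6 * x3)
      - (6 * x4' - 6 * x4)" for x0 x1 x2 x3 x4 x0' x1' x2' x3' x4' y :: int
    by (simp add: algebra_simps)
  have "6 * (vdim (cremona L) - vdim L) =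
      (D + k + 3) * (D + k + 2) * (D + k + 1) - (D + 3) * (D + 2) * (D + 1)
      - ((a + k + 2) * (a + k + 1) * (a + k) - (a + 2) * (a + 1) * a)
      - ((b + k + 2) * (b + k + 1) * (b + k) - (b + 2) * (b + 1) * b)
      - ((c + k + 2) * (c + k + 1) * (c + k) - (c + 2) * (c + 1) * c)
      - ((e + k + 2) * (e + k + 1) * (e + k) - (e + 2) * (e + 1) * e)"
    unfolding vL vCr top[symmetric] cubes[symmetric] by (rule lin)
  also have "\<dots> = ((a + b - D) ^ 3 - (a + b - D)) + ((a + c - D) ^ 3 - (a + c - D))
      + ((a + e - D) ^ 3 - (a + e - D)) + ((b + c - D) ^ 3 - (b + c - D))
      + ((b + e - D) ^ 3 - (b + e - D)) + ((c + e - D) ^ 3 - (c + e - D))"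
    \<comment> \<open>The identity depends on the specific value of \<open>k\<close>: the right-hand
      side is free of \<open>k\<close>.\<close>
    unfolding k_def power3_eq_cube by (simp add: algebra_simps)
  also have "\<dots> = 6 * (?g (a + b - D) + ?g (a + c - D) + ?g (a + e - D)
        + ?g (b + c - D) + ?g (b + e - D) + ?g (c + e - D))"
    unfolding six_times_pair_contribution[symmetric] by (simp only: distrib_left)
  finally show ?thesis unfolding rhs by simp
qed

end
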